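(* Let $\kappa>-1$, $\alpha>0$, put $m=\frac{\alpha\kappa}{1+\kappa}$, and let $\mathbf p=(p_1,\dots,p_N)$ be a probability distribution with all $p_i>0$. Let $$P_{\kappa\mathrm{avg}}=\left(\sum_{i=1}^N p_i^{1+m}\right)^{1/m}$$ be its coupled average uncertainty. Then the coupled entropy $S^{C}_{\alpha,\kappa}$, normalized Tsallis entropy $S^{NT}_{\alpha,\kappa}$, Tsallis entropy $S^{T}_{\alpha,\kappa}$ and Rényi entropy $S^{R}_{\alpha,\kappa}$ of $\mathbf p$ are the following transformations of $P_{\kappa\mathrm{avg}}$: $$S^{C}_{\alpha,\kappa}(\mathbf p)=-\ln_{-\alpha,\kappa}\left(P_{\kappa\mathrm{avg}}\right),\qquad S^{NT}_{\alpha,\kappa}(\mathbf p)=-(1+\kappa)\ln_{-\alpha,\kappa}\left(P_{\kappa\mathrm{avg}}\right),$$ $$S^{T}_{\alpha,\kappa}(\mathbf p)=-(1+\kappa)\ln_{\alpha,\kappa}\left(P_{\kappa\mathrm{avg}}\right),\qquad S^{R}_{\alpha,\kappa}(\mathbf p)=-\ln\left(P_{\kappa\mathrm{avg}}\right).$$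
   Context: For $\kappa>-1$, $\kappa\neq0$, and real $\beta\ne0$, the coupled logarithm is $\ln_{\beta,\kappa}(x)=\frac{1}{\beta\kappa}\left(x^{\frac{\beta\kappa}{1+\kappa}}-1\right)$ for $x>0$ (used with $\beta=\alpha$ and $\beta=-\alpha$). The coupled probability of $\mathbf p$ is $P_i^{(\alpha,\kappa)}=p_i^{1+m}\big/\sum_{j=1}^N p_j^{1+m}$ with $m=\frac{\alpha\kappa}{1+\kappa}$. The entropies are defined by $$S^{C}_{\alpha,\kappa}(\mathbf p)=-\sum_{i=1}^N P_i^{(\alpha,\kappa)}\ln_{-\alpha,\kappa}p_i,\qquad S^{NT}_{\alpha,\kappa}(\mathbf p)=-(1+\kappa)\,\frac{\sum_{i=1}^N p_i^{1+m}\ln_{-\alpha,\kappa}p_i}{\sum_{i=1}^N p_i^{1+m}},$$ $$S^{T}_{\alpha,\kappa}(\mathbf p)=-(1+\kappa)\sum_{i=1}^N p_i^{1+m}\ln_{-\alpha,\kappa}p_i,\qquad S^{R}_{\alpha,\kappa}(\mathbf p)=\frac{1}{1-q}\ln\sum_{i=1}^N p_i^{q}\ \text{ with } q=1+m.$$ For $\kappa=0$ all expressions are read as limits: $\ln_{\beta,0}=\ln$, $P_{\kappa\mathrm{avg}}=\prod_i p_i^{p_i}$, and $S^R$ is the Shannon entropy $-\sum_i p_i\ln p_i$. *)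

theory Defs
  imports Complex_Main
begin

text \<open>
  A distribution on \<open>{1..N}\<close> is a function \<open>p :: nat \<Rightarrow> real\<close>, of which only the values on
  \<open>{1..N}\<close> matter. For \<open>\<kappa> = 0\<close> the formulas divide by zero, so \<open>coupled_ln\<close>, \<open>coupled_avg\<close> and
  \<open>renyi_entropy\<close> are given their limit values there; the other expressions then need no case
  distinction. The lemmas below confirm that every value at \<open>\<kappa> = 0\<close> is the limit.
\<close>

definition coupled_ln :: "real \<Rightarrow> real \<Rightarrow> real \<Rightarrow> real" where
  "coupled_ln \<beta> \<kappa> x =
    (if \<kappa> = 0 then ln x
     else 1 / (\<beta> * \<kappa>) * (x powr (\<beta> * \<kappa> / (1 + \<kappa>)) - 1))"

definition coupling_exponent :: "real \<Rightarrow> real \<Rightarrow> real" where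
  "coupling_exponent \<alpha> \<kappa> = \<alpha> * \<kappa> / (1 + \<kappa>)"

definition coupled_prob :: "real \<Rightarrow> real \<Rightarrow> nat \<Rightarrow> (nat \<Rightarrow> real) \<Rightarrow> nat \<Rightarrow> real" where
  "coupled_prob \<alpha> \<kappa> N p i =
    p i powr (1 + coupling_exponent \<alpha> \<kappa>)
      / (\<Sum>j=1..N. p j powr (1 + coupling_exponent \<alpha> \<kappa>))"

definition coupled_avg :: "real \<Rightarrow> real \<Rightarrow> nat \<Rightarrow> (nat \<Rightarrow> real) \<Rightarrow> real" where
  "coupled_avg \<alpha> \<kappa> N p =
    (if \<kappa> = 0 then (\<Prod>i=1..N. p i powr p i)
     else (\<Sum>i=1..N. p i powr (1 + coupling_exponent \<alpha> \<kappa>))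
            powr (1 / coupling_exponent \<alpha> \<kappa>))"

definition coupled_entropy :: "real \<Rightarrow> real \<Rightarrow> nat \<Rightarrow> (nat \<Rightarrow> real) \<Rightarrow> real" where
  "coupled_entropy \<alpha> \<kappa> N p =
    - (\<Sum>i=1..N. coupled_prob \<alpha> \<kappa> N p i * coupled_ln (- \<alpha>) \<kappa> (p i))"

definition normalized_tsallis_entropy :: "real \<Rightarrow> real \<Rightarrow> nat \<Rightarrow> (nat \<Rightarrow> real) \<Rightarrow> real" where
  "normalized_tsallis_entropy \<alpha> \<kappa> N p =
    - (1 + \<kappa>) *
      ((\<Sum>i=1..N. p i powr (1 + coupling_exponent \<alpha> \<kappa>) * coupled_ln (- \<alpha>) \<kappa> (p i))
        / (\<Sum>i=1..N. p i powr (1 + coupling_exponent \<alpha> \<kappa>)))"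

definition tsallis_entropy :: "real \<Rightarrow> real \<Rightarrow> nat \<Rightarrow> (nat \<Rightarrow> real) \<Rightarrow> real" where
  "tsallis_entropy \<alpha> \<kappa> N p =
    - (1 + \<kappa>) *
      (\<Sum>i=1..N. p i powr (1 + coupling_exponent \<alpha> \<kappa>) * coupled_ln (- \<alpha>) \<kappa> (p i))"

definition renyi_entropy :: "real \<Rightarrow> real \<Rightarrow> nat \<Rightarrow> (nat \<Rightarrow> real) \<Rightarrow> real" where
  "renyi_entropy \<alpha> \<kappa> N p =
    (if \<kappa> = 0 then - (\<Sum>i=1..N. p i * ln (p i))
     else let q = 1 + coupling_exponent \<alpha> \<kappa>
          in 1 / (1 - q) * ln (\<Sum>i=1..N. p i powr q))"

lemma tendsto_coupled_ln:
  assumes "\<beta> \<noteq> 0" and "x > 0"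
  shows "((\<lambda>\<kappa>. coupled_ln \<beta> \<kappa> x) \<longlongrightarrow> coupled_ln \<beta> 0 x) (at 0)"
proof -
  have "((\<lambda>\<kappa>. exp (\<beta> * \<kappa> / (1 + \<kappa>) * ln x)) has_real_derivative \<beta> * ln x) (at 0)"
    by (auto intro!: derivative_eq_intros)
  then have "((\<lambda>\<kappa>. (exp (\<beta> * \<kappa> / (1 + \<kappa>) * ln x) - 1) / \<kappa>) \<longlongrightarrow> \<beta> * ln x) (at 0)"
    by (simp add: has_field_derivative_iff)
  from tendsto_divide[OF this tendsto_const[of \<beta>]]
  have "((\<lambda>\<kappa>. (exp (\<beta> * \<kappa> / (1 + \<kappa>) * ln x) - 1) / \<kappa> / \<beta>) \<longlongrightarrow> ln x) (at 0)"
    using assms by simp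
  then have "((\<lambda>\<kappa>. coupled_ln \<beta> \<kappa> x) \<longlongrightarrow> ln x) (at 0)"
    by (rule Lim_transform_eventually)
       (use assms in \<open>auto simp: eventually_at_filter coupled_ln_def powr_def field_simps\<close>)
  then show ?thesis by (simp add: coupled_ln_def)
qed

lemma tendsto_renyi_entropy:
  assumes "\<alpha> \<noteq> 0" and pos: "\<And>i. i \<in> {1..N} \<Longrightarrow> p i > 0" and sum1: "(\<Sum>i=1..N. p i) = 1"
  shows "((\<lambda>\<kappa>. renyi_entropy \<alpha> \<kappa> N p) \<longlongrightarrow> renyi_entropy \<alpha> 0 N p) (at 0)"
proof -
  let ?H = "\<Sum>i=1..N. p i * ln (p i)"
  let ?Z = "\<lambda>m. \<Sum>i=1..N. p i powr (1 + m)"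
  have Z0: "?Z 0 = 1"
    using sum1 pos by (simp add: less_imp_le)
  have "((\<lambda>m. \<Sum>i=1..N. exp ((1 + m) * ln (p i))) has_real_derivative ?H) (at 0)"
    using pos by (auto intro!: derivative_eq_intros DERIV_sum sum.cong)
  moreover have "(\<lambda>m. \<Sum>i=1..N. exp ((1 + m) * ln (p i))) = ?Z"
    using pos by (intro ext sum.cong) (fastforce simp: powr_def)+
  ultimately have "(?Z has_real_derivative ?H) (at 0)" by simp
  from DERIV_ln[of "?Z 0", unfolded Z0]
  have "((\<lambda>m. ln (?Z m)) has_real_derivative ?H) (at 0)"
    using DERIV_chain2[of ln 1 "?Z" 0 ?H] \<open>(?Z has_real_derivative ?H) (at 0)\<close> Z0 by simp
  then have lim: "((\<lambda>m. ln (?Z m) / m) \<longlongrightarrow> ?H) (at 0)"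
    using Z0 by (simp add: has_field_derivative_iff)
  have "((\<lambda>\<kappa>. coupling_exponent \<alpha> \<kappa>) \<longlongrightarrow> 0) (at 0)"
    unfolding coupling_exponent_def by (auto intro!: tendsto_eq_intros)
  moreover have ev: "\<forall>\<^sub>F \<kappa> in at 0. \<kappa> > - 1 \<and> \<kappa> \<noteq> (0::real)"
    unfolding eventually_at by (rule exI[of _ 1]) (auto simp: dist_real_def)
  then have "\<forall>\<^sub>F \<kappa> in at 0. coupling_exponent \<alpha> \<kappa> \<noteq> 0"
    by eventually_elim (use assms(1) in \<open>auto simp: coupling_exponent_def\<close>)
  ultimately have "filterlim (coupling_exponent \<alpha>) (at 0) (at 0)"
    by (simp add: filterlim_at)
  from tendsto_minus[OF filterlim_compose[OF lim this]]
  have "((\<lambda>\<kappa>. renyi_entropy \<alpha> \<kappa> N p) \<longlongrightarrow> - ?H) (at 0)"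
    by (rule Lim_transform_eventually)
       (use assms in \<open>auto simp: eventually_at_filter renyi_entropy_def\<close>)
  then show ?thesis by (simp add: renyi_entropy_def)
qed

lemma tendsto_coupled_avg:
  assumes "\<alpha> \<noteq> 0" and pos: "\<And>i. i \<in> {1..N} \<Longrightarrow> p i > 0" and sum1: "(\<Sum>i=1..N. p i) = 1"
  shows "((\<lambda>\<kappa>. coupled_avg \<alpha> \<kappa> N p) \<longlongrightarrow> coupled_avg \<alpha> 0 N p) (at 0)"
proof -
  have ne: "{1..N} \<noteq> {}" using sum1 by (metis sum.empty zero_neq_one)
  have Zpos: "(\<Sum>i=1..N. p i powr q) > 0" for q
    using ne pos by (intro sum_pos) fastforce+
  have 0: "coupled_avg \<alpha> 0 N p = exp (- renyi_entropy \<alpha> 0 N p)"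
    unfolding coupled_avg_def renyi_entropy_def
    using pos by (fastforce simp: exp_sum powr_def intro!: prod.cong)
  have *: "exp (- renyi_entropy \<alpha> \<kappa> N p) = coupled_avg \<alpha> \<kappa> N p" if "\<kappa> \<noteq> 0" for \<kappa>
    using that Zpos[of "1 + coupling_exponent \<alpha> \<kappa>"]
    by (simp add: coupled_avg_def renyi_entropy_def powr_def)
  from tendsto_exp[OF tendsto_minus[OF tendsto_renyi_entropy[OF assms]]]
  show ?thesis unfolding 0
    by (rule Lim_transform_eventually) (auto simp: eventually_at_filter *)
qed

lemma tendsto_coupled_entropies:
  assumes "\<alpha> \<noteq> 0" and pos: "\<And>i. i \<in> {1..N} \<Longrightarrow> p i > 0" and sum1: "(\<Sum>i=1..N. p i) = 1"
  shows "((\<lambda>\<kappa>. coupled_entropy \<alpha> \<kappa> N p) \<longlongrightarrow> coupled_entropy \<alpha> 0 N p) (at 0)"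
    and "((\<lambda>\<kappa>. normalized_tsallis_entropy \<alpha> \<kappa> N p) \<longlongrightarrow> normalized_tsallis_entropy \<alpha> 0 N p) (at 0)"
    and "((\<lambda>\<kappa>. tsallis_entropy \<alpha> \<kappa> N p) \<longlongrightarrow> tsallis_entropy \<alpha> 0 N p) (at 0)"
proof -
  have m: "(coupling_exponent \<alpha> \<longlongrightarrow> coupling_exponent \<alpha> 0) (at 0)"
    unfolding coupling_exponent_def by (auto intro!: tendsto_eq_intros)
  have w: "((\<lambda>\<kappa>. p i powr (1 + coupling_exponent \<alpha> \<kappa>))
              \<longlongrightarrow> p i powr (1 + coupling_exponent \<alpha> 0)) (at 0)" if "i \<in> {1..N}" for i
    using pos[OF that] by (intro tendsto_powr tendsto_intros m) auto
  have l: "((\<lambda>\<kappa>. coupled_ln (- \<alpha>) \<kappa> (p i)) \<longlongrightarrow> coupled_ln (- \<alpha>) 0 (p i)) (at 0)"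
    if "i \<in> {1..N}" for i
    using assms(1) pos[OF that] by (intro tendsto_coupled_ln) auto
  have "(\<Sum>j=1..N. p j powr (1 + coupling_exponent \<alpha> 0)) = 1"
    using pos sum1 by (simp add: coupling_exponent_def less_imp_le)
  then have Z: "(\<Sum>j=1..N. p j powr (1 + coupling_exponent \<alpha> 0)) \<noteq> 0" by linarith
  show "((\<lambda>\<kappa>. coupled_entropy \<alpha> \<kappa> N p) \<longlongrightarrow> coupled_entropy \<alpha> 0 N p) (at 0)"
    unfolding coupled_entropy_def coupled_prob_def by (intro tendsto_intros w l Z)
  show "((\<lambda>\<kappa>. normalized_tsallis_entropy \<alpha> \<kappa> N p) \<longlongrightarrow> normalized_tsallis_entropy \<alpha> 0 N p) (at 0)"
    unfolding normalized_tsallis_entropy_def by (intro tendsto_intros w l Z)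
  show "((\<lambda>\<kappa>. tsallis_entropy \<alpha> \<kappa> N p) \<longlongrightarrow> tsallis_entropy \<alpha> 0 N p) (at 0)"
    unfolding tsallis_entropy_def by (intro tendsto_intros w l)
qed

end

theory Submission
  imports Defs
begin

text \<open>
  Write \<open>m\<close> for \<open>coupling_exponent \<alpha> \<kappa>\<close>. Since \<open>p\<^sub>i\<^sup>1\<^sup>+\<^sup>m = p\<^sub>i p\<^sub>i\<^sup>m\<close>, the coupled
  average is the power mean of order \<open>m\<close> (the geometric mean if \<open>\<kappa> = 0\<close>) of the
  numbers \<open>p\<^sub>i\<close>, weighted by the \<open>p\<^sub>i\<close> themselves. As \<open>coupled_ln \<alpha> \<kappa>\<close> is an affine function
  of the \<open>m\<close>-th power (and is \<open>ln\<close> if \<open>\<kappa> = 0\<close>), the arithmetic mean, with the same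
  weights, of the numbers \<open>coupled_ln \<alpha> \<kappa> p\<^sub>i\<close> is \<open>coupled_ln \<alpha> \<kappa>\<close> of the coupled average (\<open>mean_coupled_ln\<close>).

  The entropies use \<open>coupled_ln (- \<alpha>) \<kappa>\<close> instead. The two logarithms of \<open>x\<close> differ by the
  factor \<open>x\<^sup>m\<close> (\<open>coupled_ln_reflect\<close>). At \<open>x = p\<^sub>i\<close> this factor turns the weight \<open>p\<^sub>i\<^sup>1\<^sup>+\<^sup>m\<close> into
  \<open>p\<^sub>i\<close>, which gives the Tsallis entropy. At the coupled average it is the normalizing sum
  \<open>\<Sum>\<^sub>j p\<^sub>j\<^sup>1\<^sup>+\<^sup>m\<close> (\<open>coupled_avg_powr\<close>), so dividing by that sum turns \<open>coupled_ln \<alpha> \<kappa>\<close> back into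
  \<open>coupled_ln (- \<alpha>) \<kappa>\<close>, which gives the coupled and the normalized Tsallis entropies.
  The Renyi entropy is minus the logarithm of the average because \<open>1 - q = - m\<close>.
\<close>

lemma coupled_ln_reflect:
  assumes "x > 0"
  shows "x powr coupling_exponent \<beta> \<kappa> * coupled_ln (- \<beta>) \<kappa> x = coupled_ln \<beta> \<kappa> x"
proof (cases "\<kappa> = 0")
  case True
  then show ?thesis using assms by (simp add: coupled_ln_def coupling_exponent_def)
next
  case False
  have "x powr coupling_exponent \<beta> \<kappa> * x powr (- coupling_exponent \<beta> \<kappa>) = 1"
    using assms by (simp flip: powr_add)
  then show ?thesis
    using False by (simp add: coupled_ln_def coupling_exponent_def algebra_simps diff_divide_distrib)
qed

lemma sum_powr_pos:
  fixes p :: "nat \<Rightarrow> real"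
  assumes pos: "\<And>i. i \<in> {1..N} \<Longrightarrow> p i > 0" and sum1: "(\<Sum>i=1..N. p i) = 1"
  shows "(\<Sum>i=1..N. p i powr q) > 0"
proof -
  have "{1..N} \<noteq> {}" using sum1 by (metis sum.empty zero_neq_one)
  then show ?thesis using pos by (intro sum_pos) fastforce+
qed

lemma coupled_avg_pos:
  assumes "\<And>i. i \<in> {1..N} \<Longrightarrow> p i > 0" and "(\<Sum>i=1..N. p i) = 1"
  shows "coupled_avg \<alpha> \<kappa> N p > 0"
  using sum_powr_pos[of N p "1 + coupling_exponent \<alpha> \<kappa>"] assms
  by (fastforce simp: coupled_avg_def intro!: prod_pos)

text \<open>
  At \<open>\<kappa> = 0\<close> the exponent vanishes and both sides equal the total probability; elsewhere the
  outer exponents cancel.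
\<close>
lemma coupled_avg_powr:
  assumes "\<kappa> > - 1" and "\<alpha> \<noteq> 0"
    and pos: "\<And>i. i \<in> {1..N} \<Longrightarrow> p i > 0" and sum1: "(\<Sum>i=1..N. p i) = 1"
  shows "coupled_avg \<alpha> \<kappa> N p powr coupling_exponent \<alpha> \<kappa>
       = (\<Sum>i=1..N. p i powr (1 + coupling_exponent \<alpha> \<kappa>))"
proof (cases "\<kappa> = 0")
  case True
  then show ?thesis
    using pos sum1 coupled_avg_pos[of N p \<alpha> 0] by (simp add: coupling_exponent_def less_imp_le)
next
  case False
  then have "coupling_exponent \<alpha> \<kappa> \<noteq> 0"
    using assms(1,2) by (simp add: coupling_exponent_def)
  then show ?thesis
    using False sum_powr_pos[of N p "1 + coupling_exponent \<alpha> \<kappa>"] pos sum1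
    by (simp add: coupled_avg_def powr_powr)
qed

lemma ln_coupled_avg_0:
  assumes pos: "\<And>i. i \<in> {1..N} \<Longrightarrow> p i > 0"
  shows "ln (coupled_avg \<alpha> 0 N p) = (\<Sum>i=1..N. p i * ln (p i))"
proof -
  have "ln (\<Prod>i=1..N. p i powr p i) = (\<Sum>i=1..N. ln (p i powr p i))"
    using pos by (intro ln_prod) fastforce+
  also have "\<dots> = (\<Sum>i=1..N. p i * ln (p i))"
    using pos by (intro sum.cong) (fastforce simp: ln_powr)+
  finally show ?thesis by (simp add: coupled_avg_def)
qed

text \<open>
  The defining property of a quasi-arithmetic mean: \<open>coupled_ln \<alpha> \<kappa>\<close> is a generator of the
  power mean that defines the coupled average.
\<close>
lemma mean_coupled_ln:
  assumes "\<kappa> > - 1" and "\<alpha> \<noteq> 0"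
    and pos: "\<And>i. i \<in> {1..N} \<Longrightarrow> p i > 0" and sum1: "(\<Sum>i=1..N. p i) = 1"
  shows "(\<Sum>i=1..N. p i * coupled_ln \<alpha> \<kappa> (p i)) = coupled_ln \<alpha> \<kappa> (coupled_avg \<alpha> \<kappa> N p)"
proof (cases "\<kappa> = 0")
  case True
  then show ?thesis using ln_coupled_avg_0[of N p \<alpha>] pos by (simp add: coupled_ln_def)
next
  case False
  let ?m = "coupling_exponent \<alpha> \<kappa>"
  have ln: "coupled_ln \<alpha> \<kappa> x = 1 / (\<alpha> * \<kappa>) * (x powr ?m - 1)" for x
    using False by (simp add: coupled_ln_def coupling_exponent_def)
  have "(\<Sum>i=1..N. p i * coupled_ln \<alpha> \<kappa> (p i))
      = (\<Sum>i=1..N. 1 / (\<alpha> * \<kappa>) * (p i powr (1 + ?m) - p i))"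
  proof (intro sum.cong refl)
    fix i assume "i \<in> {1..N}"
    then have "p i powr (1 + ?m) = p i * p i powr ?m"
      using pos by (simp add: powr_add less_imp_le)
    then show "p i * coupled_ln \<alpha> \<kappa> (p i) = 1 / (\<alpha> * \<kappa>) * (p i powr (1 + ?m) - p i)"
      by (simp add: ln algebra_simps)
  qed
  also have "\<dots> = 1 / (\<alpha> * \<kappa>) * ((\<Sum>i=1..N. p i powr (1 + ?m)) - 1)"
    by (simp only: sum1 sum_subtractf flip: sum_distrib_left)
  finally show ?thesis
    using coupled_avg_powr[OF assms] by (simp add: ln)
qed

theorem mainTheorem3:
  fixes \<kappa> \<alpha> :: real and N :: nat and p :: "nat \<Rightarrow> real"
  assumes "\<kappa> > - 1" and "\<alpha> > 0"
    and "\<And>i. i \<in> {1..N} \<Longrightarrow> p i > 0"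
    and "(\<Sum>i=1..N. p i) = 1"
  shows "coupled_entropy \<alpha> \<kappa> N p = - coupled_ln (- \<alpha>) \<kappa> (coupled_avg \<alpha> \<kappa> N p)
       \<and> normalized_tsallis_entropy \<alpha> \<kappa> N p = - (1 + \<kappa>) * coupled_ln (- \<alpha>) \<kappa> (coupled_avg \<alpha> \<kappa> N p)
       \<and> tsallis_entropy \<alpha> \<kappa> N p = - (1 + \<kappa>) * coupled_ln \<alpha> \<kappa> (coupled_avg \<alpha> \<kappa> N p)
       \<and> renyi_entropy \<alpha> \<kappa> N p = - ln (coupled_avg \<alpha> \<kappa> N p)"
proof -
  let ?m = "coupling_exponent \<alpha> \<kappa>"
  let ?A = "coupled_avg \<alpha> \<kappa> N p"
  let ?Z = "\<Sum>i=1..N. p i powr (1 + ?m)"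
  let ?T = "\<Sum>i=1..N. p i powr (1 + ?m) * coupled_ln (- \<alpha>) \<kappa> (p i)"
  have \<alpha>: "\<alpha> \<noteq> 0" using assms(2) by simp
  have Z: "?Z > 0" using sum_powr_pos assms(3,4) by blast
  have "?T = (\<Sum>i=1..N. p i * coupled_ln \<alpha> \<kappa> (p i))"
  proof (intro sum.cong refl)
    fix i assume "i \<in> {1..N}"
    then have "p i > 0" by (rule assms(3))
    then show "p i powr (1 + ?m) * coupled_ln (- \<alpha>) \<kappa> (p i) = p i * coupled_ln \<alpha> \<kappa> (p i)"
      by (simp add: powr_add mult.assoc coupled_ln_reflect)
  qed
  also have "\<dots> = coupled_ln \<alpha> \<kappa> ?A"
    by (rule mean_coupled_ln[OF assms(1) \<alpha> assms(3,4)])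
  finally have T: "?T = coupled_ln \<alpha> \<kappa> ?A" .
  also have "\<dots> = ?Z * coupled_ln (- \<alpha>) \<kappa> ?A"
    using coupled_ln_reflect[OF coupled_avg_pos[of N p \<alpha> \<kappa>], of \<alpha> \<kappa>]
      coupled_avg_powr[OF assms(1) \<alpha> assms(3,4)] assms(3,4) by simp
  finally have NT: "?T / ?Z = coupled_ln (- \<alpha>) \<kappa> ?A"
    using Z by simp
  have "coupled_entropy \<alpha> \<kappa> N p = - (?T / ?Z)"
    by (simp add: coupled_entropy_def coupled_prob_def sum_divide_distrib)
  moreover have "renyi_entropy \<alpha> \<kappa> N p = - ln ?A"
  proof (cases "\<kappa> = 0")
    case True
    then show ?thesis using ln_coupled_avg_0[of N p \<alpha>] assms(3) by (simp add: renyi_entropy_def)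
  next
    case False
    then show ?thesis using Z by (simp add: renyi_entropy_def coupled_avg_def ln_powr)
  qed
  ultimately show ?thesis
    unfolding normalized_tsallis_entropy_def tsallis_entropy_def NT unfolding T by blast
qed

end
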